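(* For positive integers $k,r$ with $k\ge r+1$, we have $$S(k,r,1)=\sum_{j=0}^{r-1}(-1)^j\,\zeta_{\mathcal{A}}^{(2)}(k-r+j+1)\,\zeta_{\mathcal{A}}^{(2)}(\{1\}^{r-j-1})\quad\text{in }\mathcal{A},$$ where $$S(k,r,1)=\sum_{a=0}^{r-1}\zeta_{\mathcal{A}}^{(2)}(\{1\}^a,k-r+1,\{1\}^{r-1-a})$$ is the sum of $\zeta_{\mathcal{A}}^{(2)}$ over all indices of weight $k$, depth $r$ and height one.
   Context: Let $\mathcal{P}$ be the set of prime numbers and $\mathcal{A}=\prod_{p\in\mathcal{P}}\mathbb{Z}/p\mathbb{Z}\big/\bigoplus_{p\in\mathcal{P}}\mathbb{Z}/p\mathbb{Z}$, which is a $\mathbb{Q}$-algebra. For a finite sequence (index) of positive integers $(k_1,\ldots,k_r)$, the level-two finite multiple zeta value is $$\zeta_{\mathcal{A}}^{(2)}(k_1,\ldots,k_r)=\left(\sum_{0<n_1<\cdots<n_r<p/2}\frac{1}{n_1^{k_1}\cdots n_r^{k_r}}\bmod p\right)_{p}\in\mathcal{A}.$$ The weight of the index is $k_1+\cdots+k_r$, its depth is $r$, and its height is the number of $j$ with $k_j\ge2$. $\{1\}^a$ denotes the sequence consisting of $1$ repeated $a$ times, with the convention $\zeta_{\mathcal{A}}^{(2)}(\{1\}^0)=1$. *)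

theory Defs
  imports "HOL-Number_Theory.Number_Theory" "HOL-Algebra.QuotRing"
begin

section \<open>Products of rings modulo direct sums\<close>

definition product_ring :: "'i set \<Rightarrow> ('i \<Rightarrow> ('a, 'b) ring_scheme) \<Rightarrow> ('i \<Rightarrow> 'a) ring"
  where "product_ring I R =
    \<lparr>carrier = (\<Pi>\<^sub>E i\<in>I. carrier (R i)),
     monoid.mult = (\<lambda>x y. \<lambda>i\<in>I. x i \<otimes>\<^bsub>R i\<^esub> y i),
     one = (\<lambda>i\<in>I. \<one>\<^bsub>R i\<^esub>),
     zero = (\<lambda>i\<in>I. \<zero>\<^bsub>R i\<^esub>),
     add = (\<lambda>x y. \<lambda>i\<in>I. x i \<oplus>\<^bsub>R i\<^esub> y i)\<rparr>"

definition direct_sum :: "'i set \<Rightarrow> ('i \<Rightarrow> ('a, 'b) ring_scheme) \<Rightarrow> ('i \<Rightarrow> 'a) set"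
  where "direct_sum I R =
    {x \<in> carrier (product_ring I R). finite {i \<in> I. x i \<noteq> \<zero>\<^bsub>R i\<^esub>}}"

lemma product_ring_cring:
  assumes "\<And>i. i \<in> I \<Longrightarrow> cring (R i)"
  shows "cring (product_ring I R)"
proof (rule cringI)
  note r = cring.axioms(1)[OF assms]
  note c = cring.axioms(2)[OF assms]
  show "abelian_group (product_ring I R)"
  proof (rule abelian_groupI)
    fix x assume x: "x \<in> carrier (product_ring I R)"
    let ?y = "\<lambda>i\<in>I. \<ominus>\<^bsub>R i\<^esub> x i"
    have "?y \<in> carrier (product_ring I R)"
      using x r by (auto simp: product_ring_def PiE_iff intro!: abelian_group.a_inv_closed ring.is_abelian_group)
    moreover have "?y \<oplus>\<^bsub>product_ring I R\<^esub> x = \<zero>\<^bsub>product_ring I R\<^esub>"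
      using x r by (auto simp: product_ring_def PiE_iff fun_eq_iff intro!: abelian_group.l_neg ring.is_abelian_group)
    ultimately show "\<exists>y\<in>carrier (product_ring I R). y \<oplus>\<^bsub>product_ring I R\<^esub> x = \<zero>\<^bsub>product_ring I R\<^esub>"
      by blast
  qed (use r in \<open>auto simp: product_ring_def PiE_iff fun_eq_iff extensional_def ring.ring_simprules\<close>)
  show "comm_monoid (product_ring I R)"
    by (rule comm_monoidI)
      (use r in \<open>auto simp: product_ring_def PiE_iff fun_eq_iff extensional_def
          ring.ring_simprules monoid.m_assoc[OF comm_monoid.axioms(1)[OF c]]
          intro: comm_monoid.m_comm[OF c]\<close>)
  show "(x \<oplus>\<^bsub>product_ring I R\<^esub> y) \<otimes>\<^bsub>product_ring I R\<^esub> z =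
      x \<otimes>\<^bsub>product_ring I R\<^esub> z \<oplus>\<^bsub>product_ring I R\<^esub> y \<otimes>\<^bsub>product_ring I R\<^esub> z"
    if "x \<in> carrier (product_ring I R)" "y \<in> carrier (product_ring I R)"
      "z \<in> carrier (product_ring I R)" for x y z
    using that r by (auto simp: product_ring_def PiE_iff fun_eq_iff ring.ring_simprules)
qed

lemma a_inv_product_ring:
  assumes "\<And>i. i \<in> I \<Longrightarrow> cring (R i)" "x \<in> carrier (product_ring I R)"
  shows "\<ominus>\<^bsub>product_ring I R\<^esub> x = (\<lambda>i\<in>I. \<ominus>\<^bsub>R i\<^esub> x i)"
proof -
  note r = cring.axioms(1)[OF assms(1)]
  interpret P: cring "product_ring I R" by (rule product_ring_cring[OF assms(1)])
  show ?thesis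
    by (rule P.minus_equality)
      (use assms(2) r in \<open>auto simp: product_ring_def PiE_iff fun_eq_iff ring.ring_simprules\<close>)
qed

lemma direct_sum_ideal:
  assumes "\<And>i. i \<in> I \<Longrightarrow> cring (R i)"
  shows "ideal (direct_sum I R) (product_ring I R)"
proof -
  note r = cring.axioms(1)[OF assms]
  interpret P: cring "product_ring I R" by (rule product_ring_cring[OF assms])
  show ?thesis
  proof (rule idealI)
    show "subgroup (direct_sum I R) (add_monoid (product_ring I R))"
    proof (rule subgroup.intro)
      show "direct_sum I R \<subseteq> carrier (add_monoid (product_ring I R))"
        by (auto simp: direct_sum_def)
      show "\<one>\<^bsub>add_monoid (product_ring I R)\<^esub> \<in> direct_sum I R"
        using r by (auto simp: direct_sum_def product_ring_def ring.ring_simprules)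
    next
      fix x y assume xy: "x \<in> direct_sum I R" "y \<in> direct_sum I R"
      have "finite {i \<in> I. (x \<oplus>\<^bsub>product_ring I R\<^esub> y) i \<noteq> \<zero>\<^bsub>R i\<^esub>}"
        by (rule finite_subset[of _ "{i \<in> I. x i \<noteq> \<zero>\<^bsub>R i\<^esub>} \<union> {i \<in> I. y i \<noteq> \<zero>\<^bsub>R i\<^esub>}"])
          (use xy r in \<open>auto simp: direct_sum_def product_ring_def ring.ring_simprules\<close>)
      then show "x \<otimes>\<^bsub>add_monoid (product_ring I R)\<^esub> y \<in> direct_sum I R"
        using xy P.a_closed by (auto simp: direct_sum_def)
    next
      fix x assume x: "x \<in> direct_sum I R"
      then have xc: "x \<in> carrier (product_ring I R)" by (simp add: direct_sum_def)
      have "finite {i \<in> I. (\<ominus>\<^bsub>product_ring I R\<^esub> x) i \<noteq> \<zero>\<^bsub>R i\<^esub>}"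
        by (rule finite_subset[of _ "{i \<in> I. x i \<noteq> \<zero>\<^bsub>R i\<^esub>}"])
          (use x r in \<open>auto simp: a_inv_product_ring[OF assms xc] direct_sum_def
             ring.minus_zero\<close>)
      then show "inv\<^bsub>add_monoid (product_ring I R)\<^esub> x \<in> direct_sum I R"
        using P.a_inv_closed[OF xc] by (auto simp: direct_sum_def a_inv_def)
    qed
  next
    fix a x assume a: "a \<in> direct_sum I R" and x: "x \<in> carrier (product_ring I R)"
    have "finite {i \<in> I. (x \<otimes>\<^bsub>product_ring I R\<^esub> a) i \<noteq> \<zero>\<^bsub>R i\<^esub>}"
      by (rule finite_subset[of _ "{i \<in> I. a i \<noteq> \<zero>\<^bsub>R i\<^esub>}"])
        (use a x r in \<open>auto simp: direct_sum_def product_ring_def ring.ring_simprules PiE_iff\<close>)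
    then show "x \<otimes>\<^bsub>product_ring I R\<^esub> a \<in> direct_sum I R"
      using a x P.m_closed by (auto simp: direct_sum_def)
    then show "a \<otimes>\<^bsub>product_ring I R\<^esub> x \<in> direct_sum I R"
      using a x P.m_comm by (simp add: direct_sum_def)
  qed (rule P.ring_axioms)
qed


section \<open>The ring \<open>\<A>\<close>\<close>

abbreviation primes :: "nat set"
  where "primes \<equiv> {p. prime p}"

abbreviation prod_Fp :: "(nat \<Rightarrow> int) ring"
  where "prod_Fp \<equiv> product_ring primes (\<lambda>p. residue_ring (int p))"

abbreviation sum_Fp :: "(nat \<Rightarrow> int) set"
  where "sum_Fp \<equiv> direct_sum primes (\<lambda>p. residue_ring (int p))"

definition ring_A :: "(nat \<Rightarrow> int) set ring"  (\<open>\<A>\<close>)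
  where "\<A> = prod_Fp Quot sum_Fp"

lemma residue_ring_prime_cring:
  assumes "prime p"
  shows "cring (residue_ring (int p))"
proof -
  interpret residues "int p" "residue_ring (int p)"
    using prime_gt_1_nat[OF assms] by unfold_locales auto
  show ?thesis by (rule cring)
qed

lemma ideal_sum_Fp: "ideal sum_Fp prod_Fp"
  by (rule direct_sum_ideal) (simp add: residue_ring_prime_cring)

lemma cring_A: "cring \<A>"
  unfolding ring_A_def
  by (intro ideal.quotient_is_cring ideal_sum_Fp product_ring_cring) (simp add: residue_ring_prime_cring)


section \<open>Level-two finite multiple zeta values\<close>

text \<open>An index \<open>(k\<^sub>1, \<dots>, k\<^sub>r)\<close> is the list \<open>[k\<^sub>1, \<dots>, k\<^sub>r]\<close>. Since \<open>0 < n < p\<close>, every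
  summation variable \<open>n\<close> is itself the element of \<open>residue_ring p\<close> that it represents.\<close>

definition summation_range :: "nat \<Rightarrow> nat \<Rightarrow> int list set"
  where "summation_range p r =
    {ns. length ns = r \<and> sorted_wrt (<) ns \<and> (\<forall>n\<in>set ns. 0 < n \<and> 2 * n < int p)}"

definition zeta2_mod :: "nat \<Rightarrow> nat list \<Rightarrow> int"
  where "zeta2_mod p ks = (let F = residue_ring (int p) in
    \<Oplus>\<^bsub>F\<^esub>ns\<in>summation_range p (length ks).
      \<Otimes>\<^bsub>F\<^esub>i\<in>{..<length ks}. inv\<^bsub>F\<^esub> ((ns ! i) [^]\<^bsub>F\<^esub> (ks ! i)))"

definition zeta2_A :: "nat list \<Rightarrow> (nat \<Rightarrow> int) set"
  where "zeta2_A ks = sum_Fp +>\<^bsub>prod_Fp\<^esub> (\<lambda>p\<in>primes. zeta2_mod p ks)"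

definition height :: "nat list \<Rightarrow> nat"
  where "height ks = length (filter (\<lambda>k. 2 \<le> k) ks)"

definition indices :: "nat \<Rightarrow> nat \<Rightarrow> nat \<Rightarrow> nat list set"
  where "indices k r h =
    {ks. (\<forall>k'\<in>set ks. 0 < k') \<and> sum_list ks = k \<and> length ks = r \<and> height ks = h}"

definition S :: "nat \<Rightarrow> nat \<Rightarrow> nat \<Rightarrow> (nat \<Rightarrow> int) set"
  where "S k r h = (\<Oplus>\<^bsub>\<A>\<^esub>ks\<in>indices k r h. zeta2_A ks)"

text \<open>Both index sets are finite, so the sums above are not the default value that
  \<^const>\<open>finsum\<close> has on infinite sets.\<close>

lemma finite_summation_range: "finite (summation_range p r)"
  by (rule finite_subset[OF _ finite_lists_length_eq[of "{0..int p}" r]])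
    (auto simp: summation_range_def)

lemma finite_indices: "finite (indices k r h)"
  by (rule finite_subset[OF _ finite_lists_length_eq[of "{0..k}" r]])
    (auto simp: indices_def dest: member_le_sum_list)

lemma zeta2_mod_closed:
  assumes "prime p"
  shows "zeta2_mod p ks \<in> carrier (residue_ring (int p))"
proof -
  interpret R: residues_prime p "residue_ring (int p)"
    using assms by unfold_locales auto
  have "inv\<^bsub>residue_ring (int p)\<^esub> (ns ! i [^]\<^bsub>residue_ring (int p)\<^esub> ks ! i)
      \<in> carrier (residue_ring (int p))"
    if "ns \<in> summation_range p (length ks)" "i < length ks" for ns i
  proof -
    have "0 < ns ! i" "2 * (ns ! i) < int p"
      using that by (auto simp: summation_range_def)
    then have "ns ! i \<in> Units (residue_ring (int p))"
      by (simp add: R.res_prime_units_eq)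
    then show ?thesis
      by (intro R.Units_inv_closed R.Units_pow_closed)
  qed
  then show ?thesis
    unfolding zeta2_mod_def Let_def by (intro R.finsum_closed funcsetI R.finprod_closed) auto
qed

lemma zeta2_A_closed: "zeta2_A ks \<in> carrier \<A>"
  unfolding zeta2_A_def ring_A_def FactRing_def A_RCOSETS_defs a_r_coset_def[symmetric]
  by (auto simp: product_ring_def a_r_coset_def r_coset_def zeta2_mod_closed PiE_iff
      extensional_def split: if_splits intro!: bexI[of _ "\<lambda>p\<in>primes. zeta2_mod p ks"])

lemma zeta2_A_Nil: "zeta2_A [] = \<one>\<^bsub>\<A>\<^esub>"
proof -
  have "zeta2_mod p [] = 1" if "prime p" for p
  proof -
    interpret cring "residue_ring (int p)" by (rule residue_ring_prime_cring[OF that])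
    have "summation_range p 0 = {[]}" by (auto simp: summation_range_def)
    then have "zeta2_mod p [] = \<one>\<^bsub>residue_ring (int p)\<^esub>"
      unfolding zeta2_mod_def by simp
    then show ?thesis by (simp add: residue_ring_def)
  qed
  then have "(\<lambda>p\<in>primes. zeta2_mod p []) = \<one>\<^bsub>prod_Fp\<^esub>"
    by (auto simp: product_ring_def residue_ring_def fun_eq_iff)
  then show ?thesis by (simp add: zeta2_A_def ring_A_def FactRing_def)
qed

end

theory Submission
  imports Defs
begin

text \<open>
  The identity holds modulo every single prime \<open>p\<close>. It is an instance of an identity between
  symmetric polynomials, and invertibility modulo \<open>p\<close> only enters through the choice of the
  variables: let \<open>N = {n. 0 < n < p/2}\<close> and let \<open>x\<^sub>n\<close> represent \<open>1/n\<close>.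

  Put \<open>m = k - r\<close> and \<open>s = r - 1\<close>. The term of the height-one sum in which the large entry
  \<open>m + 1\<close> stands at position \<open>a\<close> runs over the increasing \<open>r\<close>-tuples from \<open>N\<close> and weights each
  tuple by the product of its variables, times \<open>x\<^sup>m\<close> for the variable at position \<open>a\<close>. Summing over
  \<open>a\<close> as well means summing over all \<open>r\<close>-subsets of \<open>N\<close> with one marked element. Choosing the
  marked element \<open>n\<close> first gives
  \[ \sum_{n \in N} x_n^{m+1} \, e_s(N - n), \]
  where \<open>e\<^sub>s\<close> is the elementary symmetric polynomial (lemma \<open>sum_subsets_marked_element\<close>).

  Deleting a variable from \<open>e\<^sub>s\<close> is division of \<open>\<Prod>(1 + x\<^sub>i t)\<close> by \<open>1 + x\<^sub>n t\<close>, so that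
  \[ e_s(N - n) = \sum_{j \le s} (-x_n)^j \, e_{s-j}(N) \]
  (lemma \<open>elementary_sym_remove\<close>). After this substitution the sum over \<open>n\<close> turns the powers
  \<open>x\<^sub>n\<close> with exponent \<open>m + j + 1\<close> into a depth-one value, and \<open>e\<close> with index \<open>s - j\<close> is the value
  at \<open>s - j\<close> ones. This is \<open>nested_sum_height_one_formula\<close>.

  To carry the identity to \<open>\<A>\<close>, the truncated sums are represented by integers. Sending a sequence
  of integers, one for each prime, to its class in \<open>\<A>\<close> respects sums and products, so an
  identity between integer sequences becomes one in \<open>\<A>\<close>.
\<close>

section \<open>Elementary symmetric polynomials\<close>

definition elementary_sym :: "nat \<Rightarrow> ('b \<Rightarrow> 'a::comm_ring_1) \<Rightarrow> 'b set \<Rightarrow> 'a"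
  where "elementary_sym s x A = (\<Sum>B | B \<subseteq> A \<and> card B = s. prod x B)"

lemma elementary_sym_0:
  assumes "finite A"
  shows "elementary_sym 0 x A = 1"
proof -
  have "{B. B \<subseteq> A \<and> card B = 0} = {{}}"
    using assms by (auto dest: finite_subset)
  then show ?thesis by (simp add: elementary_sym_def)
qed

lemma subsets_through_point:
  assumes "finite N" "b \<in> N"
  shows "bij_betw (insert b) {C. C \<subseteq> N - {b} \<and> card C = s}
           {B. B \<subseteq> N \<and> card B = Suc s \<and> b \<in> B}"
proof (rule bij_betw_byWitness[where f' = "\<lambda>B. B - {b}"])
  show "insert b ` {C. C \<subseteq> N - {b} \<and> card C = s}
      \<subseteq> {B. B \<subseteq> N \<and> card B = Suc s \<and> b \<in> B}"
  proof safe
    fix C assume C: "C \<subseteq> N - {b}"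
    then have "finite C" using assms(1) by (meson finite_Diff finite_subset)
    then show "card (insert b C) = Suc (card C)" using C by (subst card_insert_disjoint) auto
  qed (use assms(2) in auto)
  show "(\<lambda>B. B - {b}) ` {B. B \<subseteq> N \<and> card B = Suc s \<and> b \<in> B}
      \<subseteq> {C. C \<subseteq> N - {b} \<and> card C = s}"
    by auto
qed auto

text \<open>Removing \<open>b\<close> matches the subsets through \<open>b\<close> with the smaller subsets of \<open>N - {b}\<close>, and
  \<open>x b\<close> splits off from the product.\<close>

lemma sum_over_subsets_through_point:
  fixes x :: "'b \<Rightarrow> 'a::comm_ring_1"
  assumes "finite N" "b \<in> N"
  shows "(\<Sum>B | B \<subseteq> N \<and> card B = Suc s \<and> b \<in> B. prod x B)
           = x b * elementary_sym s x (N - {b})"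
proof -
  have "(\<Sum>B | B \<subseteq> N \<and> card B = Suc s \<and> b \<in> B. prod x B)
      = (\<Sum>C | C \<subseteq> N - {b} \<and> card C = s. prod x (insert b C))"
    by (rule sum.reindex_bij_betw[OF subsets_through_point[OF assms], symmetric])
  also have "\<dots> = (\<Sum>C | C \<subseteq> N - {b} \<and> card C = s. x b * prod x C)"
  proof (rule sum.cong)
    fix C assume C: "C \<in> {C. C \<subseteq> N - {b} \<and> card C = s}"
    then have "finite C" using assms(1) by (auto intro: finite_subset)
    then show "prod x (insert b C) = x b * prod x C" using C by (subst prod.insert) auto
  qed simp
  finally show ?thesis by (simp add: elementary_sym_def sum_distrib_left)
qed

lemma elementary_sym_Suc_remove:
  fixes x :: "'b \<Rightarrow> 'a::comm_ring_1"
  assumes "finite N" "b \<in> N"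
  shows "elementary_sym (Suc s) x N
           = elementary_sym (Suc s) x (N - {b}) + x b * elementary_sym s x (N - {b})"
proof -
  have split: "{B. B \<subseteq> N \<and> card B = Suc s}
      = {B. B \<subseteq> N - {b} \<and> card B = Suc s} \<union> {B. B \<subseteq> N \<and> card B = Suc s \<and> b \<in> B}"
    by auto
  have "elementary_sym (Suc s) x N
      = elementary_sym (Suc s) x (N - {b})
        + (\<Sum>B | B \<subseteq> N \<and> card B = Suc s \<and> b \<in> B. prod x B)"
    unfolding elementary_sym_def split
    by (rule sum.union_disjoint) (use assms(1) in auto)
  then show ?thesis by (simp add: sum_over_subsets_through_point[OF assms])
qed

text \<open>The recursion \<open>elementary_sym_Suc_remove\<close>, solved for the polynomial with \<open>b\<close> deleted,
  expresses \<open>e\<close> with index \<open>s + 1\<close> on \<open>N - {b}\<close> through \<open>e\<close> with index \<open>s\<close> on the same set.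
  Unrolling it down to index 0 produces the alternating sum.\<close>

lemma elementary_sym_remove:
  fixes x :: "'b \<Rightarrow> 'a::comm_ring_1"
  assumes "finite N" "b \<in> N"
  shows "elementary_sym s x (N - {b})
           = (\<Sum>j\<le>s. (- 1) ^ j * x b ^ j * elementary_sym (s - j) x N)"
proof (induction s)
  case 0
  then show ?case using assms by (simp add: elementary_sym_0)
next
  case (Suc s)
  have "elementary_sym (Suc s) x (N - {b})
      = elementary_sym (Suc s) x N - x b * elementary_sym s x (N - {b})"
    using elementary_sym_Suc_remove[OF assms, of s x] by (simp add: algebra_simps)
  also have "\<dots> = elementary_sym (Suc s) x N
      + (\<Sum>j\<le>s. (- 1) ^ Suc j * x b ^ Suc j * elementary_sym (s - j) x N)"
    unfolding Suc.IH by (simp add: sum_distrib_left sum_negf mult_ac)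
  also have "\<dots> = (\<Sum>j\<le>Suc s. (- 1) ^ j * x b ^ j * elementary_sym (Suc s - j) x N)"
    by (simp only: sum.atMost_Suc_shift) simp
  finally show ?case .
qed

text \<open>Double counting of the pairs of a subset \<open>B\<close> and a marked \<open>b \<in> B\<close>, weighted by
  \<open>y b\<close>: the sum on the right chooses the mark before the rest of the subset.\<close>

lemma sum_subsets_marked_element:
  fixes x y :: "'b \<Rightarrow> 'a::comm_ring_1"
  assumes "finite N"
  shows "(\<Sum>B | B \<subseteq> N \<and> card B = Suc s. prod x B * sum y B)
           = (\<Sum>b\<in>N. y b * x b * elementary_sym s x (N - {b}))"
proof -
  have "(\<Sum>B | B \<subseteq> N \<and> card B = Suc s. prod x B * sum y B)
      = (\<Sum>B | B \<subseteq> N \<and> card B = Suc s. \<Sum>b | b \<in> N \<and> b \<in> B. y b * prod x B)"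
  proof (rule sum.cong)
    fix B assume "B \<in> {B. B \<subseteq> N \<and> card B = Suc s}"
    then have "{b. b \<in> N \<and> b \<in> B} = B" by auto
    then show "prod x B * sum y B = (\<Sum>b | b \<in> N \<and> b \<in> B. y b * prod x B)"
      by (simp add: mult.commute[of "prod x B"] sum_distrib_right)
  qed simp
  also have "\<dots> = (\<Sum>b\<in>N. \<Sum>B | B \<in> {B. B \<subseteq> N \<and> card B = Suc s} \<and> b \<in> B. y b * prod x B)"
    by (rule sum.swap_restrict) (use assms in auto)
  also have "\<dots> = (\<Sum>b\<in>N. y b * (x b * elementary_sym s x (N - {b})))"
    by (rule sum.cong)
      (simp_all add: sum_over_subsets_through_point[OF assms, symmetric] sum_distrib_left conj_assoc)
  finally show ?thesis by (simp add: mult.assoc)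
qed


section \<open>Nested sums over increasing lists\<close>

definition increasing_lists :: "'b::linorder set \<Rightarrow> nat \<Rightarrow> 'b list set"
  where "increasing_lists N r = {ns. length ns = r \<and> sorted_wrt (<) ns \<and> set ns \<subseteq> N}"

text \<open>With \<open>x n = 1/n\<close> this is a truncated multiple zeta sum. The variables are left abstract, since
  the identities below hold in any commutative ring.\<close>

definition nested_sum :: "'b::linorder set \<Rightarrow> ('b \<Rightarrow> 'a::comm_ring_1) \<Rightarrow> nat list \<Rightarrow> 'a"
  where "nested_sum N x ks =
    (\<Sum>ns\<in>increasing_lists N (length ks). \<Prod>i<length ks. x (ns ! i) ^ (ks ! i))"

text \<open>An increasing list is determined by its set of entries. Hence sums over increasing lists whose
  terms are symmetric in the entries become the sums over subsets of the previous part.\<close>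

lemma bij_betw_increasing_lists:
  assumes "finite N"
  shows "bij_betw set (increasing_lists N r) {B. B \<subseteq> N \<and> card B = r}"
proof (rule bij_betw_byWitness[where f' = sorted_list_of_set])
  show "set ` increasing_lists N r \<subseteq> {B. B \<subseteq> N \<and> card B = r}"
    by (auto simp: increasing_lists_def strict_sorted_iff distinct_card)
  show "sorted_list_of_set ` {B. B \<subseteq> N \<and> card B = r} \<subseteq> increasing_lists N r"
  proof safe
    fix B assume B: "B \<subseteq> N"
    with assms have "finite B" by (rule finite_subset[rotated])
    then show "sorted_list_of_set B \<in> increasing_lists N (card B)"
      using B by (auto simp: increasing_lists_def)
  qed
qed (use assms in \<open>auto simp: increasing_lists_def strict_sorted_iff
       sorted_list_of_set_sort_remdups sorted_sort_id dest: finite_subset\<close>)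

lemma sum_increasing_lists:
  assumes "finite N"
  shows "(\<Sum>ns\<in>increasing_lists N r. g (set ns)) = (\<Sum>B | B \<subseteq> N \<and> card B = r. g B)"
  by (rule sum.reindex_bij_betw[OF bij_betw_increasing_lists[OF assms]])

lemma
  fixes f :: "'b::linorder \<Rightarrow> 'a::comm_ring_1"
  assumes "ns \<in> increasing_lists N r"
  shows prod_nth_increasing: "(\<Prod>i<r. f (ns ! i)) = prod f (set ns)"
    and sum_nth_increasing: "(\<Sum>i<r. f (ns ! i)) = sum f (set ns)"
proof -
  have "bij_betw ((!) ns) {..<r} (set ns)"
    using assms by (auto simp: increasing_lists_def strict_sorted_iff intro: bij_betw_nth)
  then show "(\<Prod>i<r. f (ns ! i)) = prod f (set ns)" "(\<Sum>i<r. f (ns ! i)) = sum f (set ns)"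
    by (rule prod.reindex_bij_betw, rule sum.reindex_bij_betw)
qed

lemma nested_sum_ones:
  fixes x :: "'b::linorder \<Rightarrow> 'a::comm_ring_1"
  assumes "finite N"
  shows "nested_sum N x (replicate s 1) = elementary_sym s x N"
proof -
  have "nested_sum N x (replicate s 1) = (\<Sum>ns\<in>increasing_lists N s. prod x (set ns))"
    unfolding nested_sum_def by (auto intro!: sum.cong simp flip: prod_nth_increasing)
  then show ?thesis by (simp add: sum_increasing_lists[OF assms] elementary_sym_def)
qed

lemma nested_sum_single:
  "nested_sum N x [m] = (\<Sum>n\<in>N. x n ^ m)"
proof -
  have "increasing_lists N (Suc 0) = (\<lambda>n. [n]) ` N"
    by (auto simp: increasing_lists_def length_Suc_conv)
  then show ?thesis by (simp add: nested_sum_def sum.reindex inj_on_def)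
qed

definition height_one :: "nat \<Rightarrow> nat \<Rightarrow> nat \<Rightarrow> nat list"
  where "height_one a m b = replicate a 1 @ [m] @ replicate b 1"

lemma length_height_one [simp]: "length (height_one a m b) = Suc (a + b)"
  by (simp add: height_one_def)

lemma nth_height_one:
  assumes "i < Suc (a + b)"
  shows "height_one a m b ! i = (if i = a then m else 1)"
  using assms by (auto simp: height_one_def nth_append nth_Cons')

lemma nested_sum_height_one:
  fixes x :: "'b::linorder \<Rightarrow> 'a::comm_ring_1"
  assumes "a \<le> s"
  shows "nested_sum N x (height_one a (Suc m) (s - a))
           = (\<Sum>ns\<in>increasing_lists N (Suc s). prod x (set ns) * x (ns ! a) ^ m)"
proof -
  have "(\<Prod>i<Suc s. x (ns ! i) ^ (height_one a (Suc m) (s - a) ! i))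
      = prod x (set ns) * x (ns ! a) ^ m"
    if "ns \<in> increasing_lists N (Suc s)" for ns
  proof -
    have "(\<Prod>i<Suc s. x (ns ! i) ^ (height_one a (Suc m) (s - a) ! i))
        = (\<Prod>i<Suc s. x (ns ! i) * (if i = a then x (ns ! i) ^ m else 1))"
      using assms by (intro prod.cong) (auto simp: nth_height_one)
    also have "\<dots> = (\<Prod>i<Suc s. x (ns ! i)) * x (ns ! a) ^ m"
      using assms by (simp only: prod.distrib) (simp add: prod.delta)
    finally show ?thesis by (simp only: prod_nth_increasing[OF that])
  qed
  then show ?thesis using assms by (auto simp: nested_sum_def intro!: sum.cong)
qed

text \<open>A single term on the left depends on the position of the large entry and is not symmetric in
  the variables. The sum over all positions is symmetric, because
  the factors \<open>x\<^sup>m\<close> add up to a power sum over the set of entries. Only then can the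
  lists be replaced by subsets.\<close>

lemma nested_sum_height_one_formula:
  fixes x :: "'b::linorder \<Rightarrow> 'a::comm_ring_1"
  assumes "finite N"
  shows "(\<Sum>a\<le>s. nested_sum N x (height_one a (Suc m) (s - a)))
           = (\<Sum>j\<le>s. (- 1) ^ j * nested_sum N x [m + j + 1] * nested_sum N x (replicate (s - j) 1))"
proof -
  let ?y = "\<lambda>n. x n ^ m"
  have "(\<Sum>a\<le>s. nested_sum N x (height_one a (Suc m) (s - a)))
      = (\<Sum>a<Suc s. \<Sum>ns\<in>increasing_lists N (Suc s). prod x (set ns) * ?y (ns ! a))"
    by (intro sum.cong) (auto simp: nested_sum_height_one)
  also have "\<dots> = (\<Sum>ns\<in>increasing_lists N (Suc s). \<Sum>a<Suc s. prod x (set ns) * ?y (ns ! a))"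
    by (rule sum.swap)
  also have "\<dots> = (\<Sum>ns\<in>increasing_lists N (Suc s). prod x (set ns) * sum ?y (set ns))"
    by (intro sum.cong refl)
      (simp only: sum_nth_increasing[of _ N "Suc s" ?y] flip: sum_distrib_left)
  also have "\<dots> = (\<Sum>B | B \<subseteq> N \<and> card B = Suc s. prod x B * sum ?y B)"
    by (rule sum_increasing_lists[OF assms])
  also have "\<dots> = (\<Sum>n\<in>N. x n ^ m * x n * elementary_sym s x (N - {n}))"
    by (rule sum_subsets_marked_element[OF assms])
  also have "\<dots> = (\<Sum>n\<in>N. \<Sum>j\<le>s. (- 1) ^ j * x n ^ (m + j + 1) * elementary_sym (s - j) x N)"
    by (intro sum.cong)
      (simp_all add: elementary_sym_remove[OF assms] sum_distrib_left power_add mult_ac)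
  also have "\<dots> = (\<Sum>j\<le>s. \<Sum>n\<in>N. (- 1) ^ j * x n ^ (m + j + 1) * elementary_sym (s - j) x N)"
    by (rule sum.swap)
  also have "\<dots> = (\<Sum>j\<le>s. (- 1) ^ j * nested_sum N x [m + j + 1]
      * nested_sum N x (replicate (s - j) 1))"
    by (simp only: nested_sum_single nested_sum_ones[OF assms] sum_distrib_left sum_distrib_right)
  finally show ?thesis .
qed


section \<open>Integer representatives of the truncated sums\<close>

text \<open>The inverses are taken in the residue field, but their powers, products and sums are those of the
  integers, without reduction. Thus identities for nested sums over a commutative ring apply
  directly.\<close>

definition zeta2_int :: "nat \<Rightarrow> nat list \<Rightarrow> int"
  where "zeta2_int p ks =
    nested_sum {n. 0 < n \<and> 2 * n < int p} (\<lambda>n. inv\<^bsub>residue_ring (int p)\<^esub> n) ks"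

lemma finite_half_range: "finite {n. 0 < n \<and> 2 * n < int p}"
  by (rule finite_subset[of _ "{0..int p}"]) auto

lemma zeta2_mod_eq:
  assumes "prime p"
  shows "zeta2_mod p ks = zeta2_int p ks mod int p"
proof -
  let ?F = "residue_ring (int p)"
  interpret R: residues_prime p ?F
    using assms by unfold_locales auto
  \<comment> \<open>The truncated sums invert powers, whereas the integer representative takes powers of
      inverses.\<close>
  have inv_pow: "inv\<^bsub>?F\<^esub> (n [^]\<^bsub>?F\<^esub> k) = (inv\<^bsub>?F\<^esub> n) ^ k mod int p"
    if "0 < n" "2 * n < int p" for n :: int and k :: nat
  proof -
    have n: "n \<in> Units ?F" using that by (simp add: R.res_prime_units_eq)
    have inv_n: "inv\<^bsub>?F\<^esub> n mod int p = inv\<^bsub>?F\<^esub> n"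
      using R.Units_inv_closed[OF n] by (auto simp: R.res_carrier_eq)
    have "n [^]\<^bsub>?F\<^esub> k \<otimes>\<^bsub>?F\<^esub> inv\<^bsub>?F\<^esub> n [^]\<^bsub>?F\<^esub> k = \<one>\<^bsub>?F\<^esub>"
      using n by (simp add: R.Units_closed flip: R.nat_pow_distrib)
    then have "inv\<^bsub>?F\<^esub> (n [^]\<^bsub>?F\<^esub> k) = inv\<^bsub>?F\<^esub> n [^]\<^bsub>?F\<^esub> k"
      using n by (intro R.comm_inv_char) (auto simp: R.Units_closed)
    also have "\<dots> = (inv\<^bsub>?F\<^esub> n) ^ k mod int p"
      using R.pow_cong[of "inv\<^bsub>?F\<^esub> n" k] by (simp add: inv_n)
    finally show ?thesis .
  qed
  have range: "increasing_lists {n. 0 < n \<and> 2 * n < int p} r = summation_range p r" for r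
    by (auto simp: increasing_lists_def summation_range_def)
  have "(\<Otimes>\<^bsub>?F\<^esub>i\<in>{..<length ks}. inv\<^bsub>?F\<^esub> ((ns ! i) [^]\<^bsub>?F\<^esub> (ks ! i)))
      = (\<Prod>i<length ks. (inv\<^bsub>?F\<^esub> (ns ! i)) ^ (ks ! i)) mod int p"
    if ns: "ns \<in> summation_range p (length ks)" for ns
  proof -
    have "(\<Otimes>\<^bsub>?F\<^esub>i\<in>{..<length ks}. inv\<^bsub>?F\<^esub> ((ns ! i) [^]\<^bsub>?F\<^esub> (ks ! i)))
        = (\<Otimes>\<^bsub>?F\<^esub>i\<in>{..<length ks}. (inv\<^bsub>?F\<^esub> (ns ! i)) ^ (ks ! i) mod int p)"
      using ns by (intro R.finprod_cong') (auto simp: inv_pow summation_range_def)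
    then show ?thesis by (simp add: R.prod_cong)
  qed
  then have "zeta2_mod p ks
      = (\<Oplus>\<^bsub>?F\<^esub>ns\<in>summation_range p (length ks).
          (\<Prod>i<length ks. (inv\<^bsub>?F\<^esub> (ns ! i)) ^ (ks ! i)) mod int p)"
    unfolding zeta2_mod_def Let_def by (intro R.finsum_cong') auto
  then show ?thesis
    by (simp add: R.sum_cong finite_summation_range zeta2_int_def nested_sum_def range)
qed

lemma zeta2_int_height_one_formula:
  "(\<Sum>a\<le>s. zeta2_int p (height_one a (Suc m) (s - a)))
     = (\<Sum>j\<le>s. (- 1) ^ j * zeta2_int p [Suc (m + j)] * zeta2_int p (replicate (s - j) 1))"
  unfolding zeta2_int_def
  using nested_sum_height_one_formula[OF finite_half_range] by simp


section \<open>From integer sequences to \<open>\<A>\<close>\<close>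

text \<open>The ring homomorphism from integer sequences to \<open>\<A>\<close>: reduce the entry at each prime \<open>p\<close>
  modulo \<open>p\<close>, then pass to the quotient.\<close>

definition class_A :: "(nat \<Rightarrow> int) \<Rightarrow> (nat \<Rightarrow> int) set"
  where "class_A f = sum_Fp +>\<^bsub>prod_Fp\<^esub> (\<lambda>p\<in>primes. f p mod int p)"

interpretation A: cring \<A>
  by (rule cring_A)

lemma reduction_closed: "(\<lambda>p\<in>primes. f p mod int p) \<in> carrier prod_Fp"
proof -
  have "f p mod int p \<in> {0..int p - 1}" if "prime p" for p
    using prime_gt_0_nat[OF that] pos_mod_bound[of "int p" "f p"] by simp
  then show ?thesis by (simp add: product_ring_def residue_ring_def)
qed

lemma quotient_hom: "(+>\<^bsub>prod_Fp\<^esub>) sum_Fp \<in> ring_hom prod_Fp \<A>"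
  unfolding ring_A_def by (rule ideal.rcos_ring_hom[OF ideal_sum_Fp])

lemma class_A_closed [simp]: "class_A f \<in> carrier \<A>"
  unfolding class_A_def by (rule ring_hom_closed[OF quotient_hom reduction_closed])

lemma class_A_add: "class_A (\<lambda>p. f p + g p) = class_A f \<oplus>\<^bsub>\<A>\<^esub> class_A g"
proof -
  have "(\<lambda>p\<in>primes. (f p + g p) mod int p)
      = (\<lambda>p\<in>primes. f p mod int p) \<oplus>\<^bsub>prod_Fp\<^esub> (\<lambda>p\<in>primes. g p mod int p)"
    by (auto simp: product_ring_def residue_ring_def fun_eq_iff mod_simps)
  then show ?thesis
    by (simp add: class_A_def ring_hom_add[OF quotient_hom reduction_closed reduction_closed])
qed

lemma class_A_mult: "class_A (\<lambda>p. f p * g p) = class_A f \<otimes>\<^bsub>\<A>\<^esub> class_A g"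
proof -
  have "(\<lambda>p\<in>primes. (f p * g p) mod int p)
      = (\<lambda>p\<in>primes. f p mod int p) \<otimes>\<^bsub>prod_Fp\<^esub> (\<lambda>p\<in>primes. g p mod int p)"
    by (auto simp: product_ring_def residue_ring_def fun_eq_iff mod_simps)
  then show ?thesis
    by (simp add: class_A_def ring_hom_mult[OF quotient_hom reduction_closed reduction_closed])
qed

lemma class_A_one: "class_A (\<lambda>p. 1) = \<one>\<^bsub>\<A>\<^esub>"
proof -
  have "1 mod int p = 1" if "prime p" for p
    using prime_gt_1_nat[OF that] by simp
  then have "(\<lambda>p\<in>primes. 1 mod int p) = \<one>\<^bsub>prod_Fp\<^esub>"
    by (auto simp: product_ring_def residue_ring_def fun_eq_iff)
  then show ?thesis
    by (simp add: class_A_def ring_hom_one[OF quotient_hom])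
qed

lemma class_A_zero: "class_A (\<lambda>p. 0) = \<zero>\<^bsub>\<A>\<^esub>"
  using class_A_add[of "\<lambda>_. 0" "\<lambda>_. 0"] A.add.r_cancel_one[of "class_A (\<lambda>_. 0)" "class_A (\<lambda>_. 0)"]
  by simp

lemma class_A_minus_one: "class_A (\<lambda>p. - 1) = \<ominus>\<^bsub>\<A>\<^esub> \<one>\<^bsub>\<A>\<^esub>"
  by (rule A.minus_equality[symmetric])
    (simp_all add: class_A_zero flip: class_A_add class_A_one)

lemma class_A_sign: "class_A (\<lambda>p. (- 1) ^ j) = (\<ominus>\<^bsub>\<A>\<^esub> \<one>\<^bsub>\<A>\<^esub>) [^]\<^bsub>\<A>\<^esub> j"
proof (induction j)
  case (Suc j)
  then show ?case
    using class_A_mult[of "\<lambda>p. (- 1) ^ j" "\<lambda>p. - 1"] by (simp add: class_A_minus_one)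
qed (simp add: class_A_one)

lemma class_A_sum:
  assumes "finite I"
  shows "class_A (\<lambda>p. \<Sum>i\<in>I. f i p) = (\<Oplus>\<^bsub>\<A>\<^esub>i\<in>I. class_A (f i))"
  using assms by (induction I) (simp_all add: class_A_zero class_A_add)

lemma zeta2_A_eq_class: "zeta2_A ks = class_A (\<lambda>p. zeta2_int p ks)"
proof -
  have "(\<lambda>p\<in>primes. zeta2_mod p ks) = (\<lambda>p\<in>primes. zeta2_int p ks mod int p)"
    by (auto simp: fun_eq_iff zeta2_mod_eq)
  then show ?thesis by (simp add: zeta2_A_def class_A_def)
qed


section \<open>Indices of height one\<close>

text \<open>The entry that is at least 2 occurs once and all others equal 1. The weight then forces that
  entry to be \<open>k - r + 1\<close>, so only its position is free. The bound \<open>r + 1 \<le> k\<close> makes this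
  value at least 2.\<close>

lemma indices_height_one:
  assumes "r > 0" "k \<ge> r + 1"
  shows "indices k r 1 = (\<lambda>a. height_one a (k - r + 1) (r - 1 - a)) ` {0..r - 1}"
proof
  show "indices k r 1 \<subseteq> (\<lambda>a. height_one a (k - r + 1) (r - 1 - a)) ` {0..r - 1}"
  proof
    fix ks assume "ks \<in> indices k r 1"
    then have pos: "\<forall>k'\<in>set ks. 0 < k'" and wt: "sum_list ks = k" and len: "length ks = r"
      and "length (filter (\<lambda>k. 2 \<le> k) ks) = 1"
      by (auto simp: indices_def height_def)
    then obtain m where "filter (\<lambda>k. 2 \<le> k) ks = [m]"
      by (auto simp: length_Suc_conv)
    then obtain us vs where ks: "ks = us @ m # vs"
      and us: "\<forall>u\<in>set us. \<not> 2 \<le> u" and vs: "[] = filter (\<lambda>k. 2 \<le> k) vs"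
      unfolding filter_eq_Cons_iff by blast
    have "u = 1" if "u \<in> set us" for u
    proof -
      have "0 < u" "\<not> 2 \<le> u" using pos us that by (auto simp: ks)
      then show ?thesis by simp
    qed
    then have us1: "us = replicate (length us) 1"
      by (intro replicate_eqI) auto
    have "v = 1" if "v \<in> set vs" for v
    proof -
      have "0 < v" "\<not> 2 \<le> v" using pos vs that by (auto simp: ks empty_filter_conv)
      then show ?thesis by simp
    qed
    then have vs1: "vs = replicate (length vs) 1"
      by (intro replicate_eqI) auto
    obtain a b where "us = replicate a 1" "vs = replicate b 1"
      using us1 vs1 by blast
    then have ab: "ks = height_one a m b"
      by (simp add: ks height_one_def)
    have "r = Suc (a + b)" using len ab by simp
    moreover have "k = a + m + b"
      using wt by (simp add: ab height_one_def sum_list_replicate)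
    ultimately have "m = k - r + 1" "b = r - 1 - a" "a \<in> {0..r - 1}"
      using assms by auto
    then show "ks \<in> (\<lambda>a. height_one a (k - r + 1) (r - 1 - a)) ` {0..r - 1}"
      using ab by blast
  qed
  show "(\<lambda>a. height_one a (k - r + 1) (r - 1 - a)) ` {0..r - 1} \<subseteq> indices k r 1"
    using assms by (auto simp: indices_def height_def height_one_def sum_list_replicate)
qed

lemma inj_on_height_one:
  assumes "m \<noteq> 1"
  shows "inj_on (\<lambda>a. height_one a m (b a)) A"
proof (rule inj_onI)
  \<comment> \<open>The position of the large entry is the number of ones in front of it.\<close>
  have takeWhile: "length (takeWhile (\<lambda>n. n = 1) (height_one a m c)) = a" for a c
    using assms by (simp add: height_one_def takeWhile_append)
  fix a a' assume "height_one a m (b a) = height_one a' m (b a')"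
  then show "a = a'" using takeWhile by metis
qed


section \<open>The sum of height one\<close>

theorem corollary3p6:
  fixes k r :: nat
  assumes "k > 0" and "r > 0" and "k \<ge> r + 1"
  shows "S k r 1 =
      (\<Oplus>\<^bsub>\<A>\<^esub>a\<in>{0..r - 1}.
        zeta2_A (replicate a 1 @ [k - r + 1] @ replicate (r - 1 - a) 1))
    \<and> S k r 1 =
      (\<Oplus>\<^bsub>\<A>\<^esub>j\<in>{0..r - 1}.
        (\<ominus>\<^bsub>\<A>\<^esub> \<one>\<^bsub>\<A>\<^esub>) [^]\<^bsub>\<A>\<^esub> j \<otimes>\<^bsub>\<A>\<^esub> zeta2_A [k - r + j + 1]
          \<otimes>\<^bsub>\<A>\<^esub> zeta2_A (replicate (r - j - 1) 1))"
proof -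
  have "S k r 1
      = (\<Oplus>\<^bsub>\<A>\<^esub>ks\<in>(\<lambda>a. height_one a (k - r + 1) (r - 1 - a)) ` {0..r - 1}. zeta2_A ks)"
    by (simp only: S_def indices_height_one[OF assms(2,3)])
  also have "\<dots> = (\<Oplus>\<^bsub>\<A>\<^esub>a\<in>{0..r - 1}. zeta2_A (height_one a (k - r + 1) (r - 1 - a)))"
    by (rule A.finsum_reindex) (use assms in \<open>auto simp: zeta2_A_closed intro: inj_on_height_one\<close>)
  finally have first: "S k r 1
      = (\<Oplus>\<^bsub>\<A>\<^esub>a\<in>{0..r - 1}. zeta2_A (height_one a (k - r + 1) (r - 1 - a)))" .
  also have "\<dots> = class_A (\<lambda>p. \<Sum>a\<in>{0..r - 1}. zeta2_int p (height_one a (k - r + 1) (r - 1 - a)))"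
    by (simp add: zeta2_A_eq_class class_A_sum)
  also have "\<dots> = class_A (\<lambda>p. \<Sum>j\<in>{0..r - 1}. (- 1) ^ j * zeta2_int p [k - r + j + 1]
      * zeta2_int p (replicate (r - j - 1) 1))"
    using zeta2_int_height_one_formula[where s = "r - 1" and m = "k - r"]
    by (simp only: atLeast0AtMost Nat.diff_commute[of r _ 1] Suc_eq_plus1[symmetric])
  also have "\<dots> = (\<Oplus>\<^bsub>\<A>\<^esub>j\<in>{0..r - 1}.
      (\<ominus>\<^bsub>\<A>\<^esub> \<one>\<^bsub>\<A>\<^esub>) [^]\<^bsub>\<A>\<^esub> j \<otimes>\<^bsub>\<A>\<^esub> zeta2_A [k - r + j + 1]
        \<otimes>\<^bsub>\<A>\<^esub> zeta2_A (replicate (r - j - 1) 1))"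
    by (simp add: class_A_sum class_A_mult class_A_sign zeta2_A_eq_class)
  finally show ?thesis using first by (simp only: height_one_def simp_thms)
qed

end
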